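(* Let $n\geq 2$ be an integer. Then $$\sum_{\sigma\in B_n}(-1)^{\ell_B(\sigma)+\mathrm{neg}(\sigma)}x^{\mathrm{ofmaj}(\sigma)}y^{\mathrm{odes}(\sigma)}z^{\mathrm{oneg}(\sigma)}=\left\lfloor\tfrac n2\right\rfloor!\,(1+xz)^{p_{n+1}}(1-xz)^{\lfloor n/2\rfloor}\prod_{i=1}^{\lfloor n/2\rfloor}(1-yx^{2i}),$$ and $$\sum_{\sigma\in B_n}(-1)^{\ell_B(\sigma)+\mathrm{neg}(\sigma)}x^{\mathrm{efmaj}(\sigma)}y^{\mathrm{edes}(\sigma)}z^{\mathrm{eneg}(\sigma)}=p_{n+1}\left\lfloor\tfrac n2\right\rfloor!\,(1+y)(1-xz)^{\lfloor n/2\rfloor}\prod_{i=1}^{\lfloor n/2\rfloor}(1-yx^{2i}).$$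
   Context: $B_n$ is the hyperoctahedral group: the group of bijections $\sigma$ of $\{-n,\dots,-1,1,\dots,n\}$ with $\sigma(-i)=-\sigma(i)$ for all $i$. For $\sigma\in B_n$ put $\sigma(0)=0$ and let $D(\sigma)=\{i\in\{0,1,\dots,n-1\}:\sigma(i)>\sigma(i+1)\}$, $\mathrm{Neg}(\sigma)=\{i\in\{1,\dots,n\}:\sigma(i)<0\}$, $\mathrm{neg}(\sigma)=|\mathrm{Neg}(\sigma)|$. The Coxeter length is $\ell_B(\sigma)=|\{(i,j):1\le i<j\le n,\ \sigma(i)>\sigma(j)\}|-\sum_{i\in\mathrm{Neg}(\sigma)}\sigma(i)$. For a set $J$ of integers, $J_o$ and $J_e$ denote its subsets of odd, respectively even, elements ($0$ is even). Define $\mathrm{odes}(\sigma)=|D(\sigma)_o|$, $\mathrm{edes}(\sigma)=|D(\sigma)_e|$, $\mathrm{omaj}(\sigma)=\sum_{i\in D(\sigma)_o}\frac{i+1}{2}$, $\mathrm{emaj}(\sigma)=\sum_{i\in D(\sigma)_e}\frac{i}{2}$, $\mathrm{oneg}(\sigma)=|\mathrm{Neg}(\sigma)_o|$, $\mathrm{eneg}(\sigma)=|\mathrm{Neg}(\sigma)_e|$, $\mathrm{ofmaj}(\sigma)=2\,\mathrm{omaj}(\sigma)+\mathrm{oneg}(\sigma)$, $\mathrm{efmaj}(\sigma)=2\,\mathrm{emaj}(\sigma)+\mathrm{eneg}(\sigma)$. For an integer $k$, $p_k=(1+(-1)^k)/2$. *)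

theory Defs
  imports Main "HOL-Combinatorics.Permutations"
begin

(* Signed permutations are functions on all of int. The predicate permutes forces them to be
   the identity off {-n..n} - {0}, so each bijection of that set is represented exactly once
   and the convention sigma(0) = 0 holds automatically (lemma signed_perm_zero). *)
definition signed_perms :: "nat \<Rightarrow> (int \<Rightarrow> int) set" where
  "signed_perms n =
     {\<sigma>. \<sigma> permutes ({- int n..int n} - {0}) \<and>
          (\<forall>i\<in>{- int n..int n} - {0}. \<sigma> (- i) = - \<sigma> i)}"

lemma finite_signed_perms: "finite (signed_perms n)"
  unfolding signed_perms_def
  by (rule finite_subset[OF _ finite_permutations[of "{- int n..int n} - {0}"]]) auto

lemma signed_perm_zero: "\<sigma> \<in> signed_perms n \<Longrightarrow> \<sigma> 0 = 0"
  by (auto simp: signed_perms_def permutes_not_in)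

definition Des :: "nat \<Rightarrow> (int \<Rightarrow> int) \<Rightarrow> nat set" where
  "Des n \<sigma> = {i \<in> {0..<n}. \<sigma> (int i) > \<sigma> (int (i + 1))}"

definition Neg :: "nat \<Rightarrow> (int \<Rightarrow> int) \<Rightarrow> nat set" where
  "Neg n \<sigma> = {i \<in> {1..n}. \<sigma> (int i) < 0}"

definition neg :: "nat \<Rightarrow> (int \<Rightarrow> int) \<Rightarrow> nat" where
  "neg n \<sigma> = card (Neg n \<sigma>)"

(* The truncation by nat is harmless: see int_length_B. *)
definition length_B :: "nat \<Rightarrow> (int \<Rightarrow> int) \<Rightarrow> nat" where
  "length_B n \<sigma> =
     nat (int (card {(i, j). 1 \<le> i \<and> i < j \<and> j \<le> n \<and> \<sigma> (int i) > \<sigma> (int j)})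
          - (\<Sum>i\<in>Neg n \<sigma>. \<sigma> (int i)))"

lemma int_length_B:
  "int (length_B n \<sigma>) =
     int (card {(i, j). 1 \<le> i \<and> i < j \<and> j \<le> n \<and> \<sigma> (int i) > \<sigma> (int j)})
     - (\<Sum>i\<in>Neg n \<sigma>. \<sigma> (int i))"
proof -
  have "(\<Sum>i\<in>Neg n \<sigma>. \<sigma> (int i)) \<le> 0"
    by (rule sum_nonpos) (auto simp: Neg_def)
  then show ?thesis
    unfolding length_B_def by (subst nat_0_le) auto
qed

definition odd_part :: "nat set \<Rightarrow> nat set" where
  "odd_part J = {i \<in> J. odd i}"

definition even_part :: "nat set \<Rightarrow> nat set" where
  "even_part J = {i \<in> J. even i}"

definition odes :: "nat \<Rightarrow> (int \<Rightarrow> int) \<Rightarrow> nat" where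
  "odes n \<sigma> = card (odd_part (Des n \<sigma>))"

definition edes :: "nat \<Rightarrow> (int \<Rightarrow> int) \<Rightarrow> nat" where
  "edes n \<sigma> = card (even_part (Des n \<sigma>))"

definition omaj :: "nat \<Rightarrow> (int \<Rightarrow> int) \<Rightarrow> nat" where
  "omaj n \<sigma> = (\<Sum>i\<in>odd_part (Des n \<sigma>). (i + 1) div 2)"

definition emaj :: "nat \<Rightarrow> (int \<Rightarrow> int) \<Rightarrow> nat" where
  "emaj n \<sigma> = (\<Sum>i\<in>even_part (Des n \<sigma>). i div 2)"

definition oneg :: "nat \<Rightarrow> (int \<Rightarrow> int) \<Rightarrow> nat" where
  "oneg n \<sigma> = card (odd_part (Neg n \<sigma>))"

definition eneg :: "nat \<Rightarrow> (int \<Rightarrow> int) \<Rightarrow> nat" where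
  "eneg n \<sigma> = card (even_part (Neg n \<sigma>))"

definition ofmaj :: "nat \<Rightarrow> (int \<Rightarrow> int) \<Rightarrow> nat" where
  "ofmaj n \<sigma> = 2 * omaj n \<sigma> + oneg n \<sigma>"

definition efmaj :: "nat \<Rightarrow> (int \<Rightarrow> int) \<Rightarrow> nat" where
  "efmaj n \<sigma> = 2 * emaj n \<sigma> + eneg n \<sigma>"

(* Natural-valued because it also serves as an exponent; the division is exact. *)
definition parity_ind :: "nat \<Rightarrow> nat" where
  "parity_ind k = nat ((1 + (- 1) ^ k) div 2)"

lemma parity_ind_eq: "parity_ind k = (if even k then 1 else 0)"
  by (simp add: parity_ind_def)

end

theory Submission
  imports Defs
begin

text \<open>
  The sign \<open>(-1)^(length_B n \<sigma> + neg n \<sigma>)\<close> ignores the signs of the values of \<open>\<sigma>\<close>: it is the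
  sign of the permutation \<open>i \<mapsto> \<bar>\<sigma> i\<bar>\<close> (\<open>neg_one_power_length_B\<close>). Write \<open>\<sigma>\<close> as the word
  \<open>\<sigma> 1 \<dots> \<sigma> n\<close>. An odd descent only compares the two letters of one of the disjoint blocks
  \<open>(\<sigma> 1, \<sigma> 2), (\<sigma> 3, \<sigma> 4), \<dots>\<close>, and an odd negative position is the first position of
  such a block, or the last position if \<open>n\<close> is odd. So the first monomial is a product of block
  weights: with \<open>t = x z\<close> and \<open>Y = y x^(2k)\<close>, block \<open>k\<close> contributes \<open>t\<close> if its first letter is
  negative and \<open>Y\<close> if it is a descent.

  Fix two absolute values for a block and sum over the choices of signs. If the absolute values
  increase, the sum is \<open>1 + t + Y + t Y\<close>; if they decrease it is \<open>2 t + 2 Y\<close>. Exchanging the two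
  absolute values changes the sign of the permutation, so only the difference
  \<open>(1 - t) (1 - Y)\<close> matters, and it does not depend on the values chosen. What remains is to
  count, with sign, the pairs \<open>a < b\<close> of an \<open>m\<close>-element set that can start the word: the signs are
  \<open>(-1)^(rank a + rank b - 1)\<close> and add up to \<open>m div 2\<close>. Removing the blocks one by one
  (\<open>signed_sum_pair_weight\<close>) gives the factorial and the product; a letter left over at the end has
  only one possible absolute value and contributes \<open>1 + t\<close>.

  For the even statistics the first letter stands alone and the blocks start at position \<open>2\<close>. As
  \<open>\<sigma> 0 = 0\<close>, there is a descent at \<open>0\<close> exactly if the first letter is negative, which gives the
  factor \<open>1 + y\<close>. The absolute value of the first letter only enters through an alternating sum
  over its rank, which is \<open>1\<close> for odd \<open>n\<close> and \<open>0\<close> for even \<open>n\<close> (\<open>signed_sum_pair_weight_tl\<close>).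

  The induction removes arbitrary letters, so it runs over words whose absolute values form an
  arbitrary finite set \<open>A\<close> of positive integers. The resulting sums depend on \<open>card A\<close> only.
\<close>

section \<open>Alternating sums over ranks\<close>

definition rank :: "int set \<Rightarrow> int \<Rightarrow> nat" where
  "rank A a = card {c \<in> A. c < a}"

lemma rank_insert_greater:
  assumes "finite A" "\<forall>c\<in>A. c < b"
  shows "a \<in> A \<Longrightarrow> rank (insert b A) a = rank A a" and "rank (insert b A) b = card A"
proof -
  have "{c \<in> insert b A. c < a} = {c \<in> A. c < a}" if "a \<in> A"
    using assms(2) that by auto
  then show "a \<in> A \<Longrightarrow> rank (insert b A) a = rank A a" by (simp add: rank_def)
  have "{c \<in> insert b A. c < b} = A" using assms(2) by auto
  then show "rank (insert b A) b = card A" by (simp add: rank_def)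
qed

lemma rank_remove:
  assumes "finite A" "a \<in> A"
  shows "rank A b = rank (A - {a}) b + (if a < b then 1 else 0)"
proof (cases "a < b")
  case True
  then have "{c \<in> A. c < b} = insert a {c \<in> A - {a}. c < b}" using assms(2) by auto
  then show ?thesis using True assms(1) by (simp add: rank_def)
next
  case False
  then have "{c \<in> A. c < b} = {c \<in> A - {a}. c < b}" by auto
  then show ?thesis using False by (simp add: rank_def)
qed

lemma alternating_rank_sum:
  assumes "finite A"
  shows "(\<Sum>a\<in>A. (- 1 :: 'a :: comm_ring_1) ^ rank A a) = of_nat (card A mod 2)"
  using assms
proof (induction rule: finite_linorder_max_induct)
  case (insert b A)
  have "b \<notin> A" using insert.hyps by auto
  then have "(\<Sum>a\<in>insert b A. (- 1 :: 'a) ^ rank (insert b A) a)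
      = (- 1) ^ card A + (\<Sum>a\<in>A. (- 1) ^ rank A a)"
    using insert.hyps by (simp add: rank_insert_greater)
  also have "\<dots> = of_nat (card (insert b A) mod 2)"
    using insert.hyps insert.IH \<open>b \<notin> A\<close> by (cases "even (card A)") (auto simp: mod_Suc odd_iff_mod_2_eq_one even_iff_mod_2_eq_zero)
  finally show ?case .
qed simp

text \<open>
  A new maximal element \<open>b\<close> adds the pairs \<open>(a, b)\<close> with \<open>a \<in> A\<close>, whose alternating sum is \<open>1\<close>
  or \<open>0\<close> according to the parity of \<open>card A\<close>. The sum thus grows by \<open>1\<close> at every second step.
\<close>

lemma alternating_rank_sum_pairs:
  assumes "finite A"
  shows "(\<Sum>b\<in>A. \<Sum>a\<in>{a\<in>A. a < b}. - ((- 1 :: 'a :: comm_ring_1) ^ (rank A a + rank A b)))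
      = of_nat (card A div 2)"
  using assms
proof (induction rule: finite_linorder_max_induct)
  case (insert b A)
  have "b \<notin> A" using insert.hyps by auto
  have new: "{a \<in> insert b A. a < b} = A" using insert.hyps by auto
  have old: "{a \<in> insert b A. a < c} = {a \<in> A. a < c}" if "c \<in> A" for c
    using insert.hyps that by auto
  have "(\<Sum>c\<in>insert b A. \<Sum>a\<in>{a \<in> insert b A. a < c}.
            - ((- 1 :: 'a) ^ (rank (insert b A) a + rank (insert b A) c)))
      = (\<Sum>a\<in>A. - ((- 1) ^ (rank A a + card A)))
        + (\<Sum>c\<in>A. \<Sum>a\<in>{a \<in> A. a < c}. - ((- 1) ^ (rank A a + rank A c)))"
    using insert.hyps \<open>b \<notin> A\<close>
    by (simp add: new old rank_insert_greater del: insert_iff cong: sum.cong) (simp add: rank_insert_greater)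
  also have "(\<Sum>a\<in>A. - ((- 1 :: 'a) ^ (rank A a + card A))) = - ((- 1) ^ card A * of_nat (card A mod 2))"
    by (simp only: sum_negf power_add sum_distrib_right [symmetric] alternating_rank_sum insert.hyps mult.commute [of "(- 1) ^ card A"])
  also have "\<dots> = of_nat (card A mod 2)"
    by (cases "even (card A)") (auto simp: odd_iff_mod_2_eq_one even_iff_mod_2_eq_zero)
  also have "of_nat (card A mod 2) + (\<Sum>c\<in>A. \<Sum>a\<in>{a \<in> A. a < c}. - ((- 1 :: 'a) ^ (rank A a + rank A c)))
      = of_nat (card A mod 2 + card A div 2)"
    by (simp only: insert.IH of_nat_add)
  also have "card A mod 2 + card A div 2 = card (insert b A) div 2"
    using insert.hyps \<open>b \<notin> A\<close> by simp presburger
  finally show ?case .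
qed simp

lemma sum_ordered_pairs:
  fixes g :: "int \<Rightarrow> int \<Rightarrow> 'a :: comm_monoid_add"
  assumes "finite A"
  shows "(\<Sum>a\<in>A. \<Sum>b\<in>A - {a}. g a b) = (\<Sum>b\<in>A. \<Sum>a\<in>{a\<in>A. a < b}. g a b + g b a)"
proof -
  have split: "(\<Sum>b\<in>A - {a}. g a b) = (\<Sum>b\<in>{b\<in>A. b < a}. g a b) + (\<Sum>b\<in>{b\<in>A. a < b}. g a b)" for a
  proof -
    have "A - {a} = {b\<in>A. b < a} \<union> {b\<in>A. a < b}" by auto
    then show ?thesis using assms by (simp add: sum.union_disjoint disjoint_iff)
  qed
  have swap: "(\<Sum>a\<in>A. \<Sum>b\<in>{b\<in>A. a < b}. g a b) = (\<Sum>b\<in>A. \<Sum>a\<in>{a\<in>A. a < b}. g a b)"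
    using sum.swap_restrict [OF assms assms] .
  show ?thesis
    by (simp add: split sum.distrib swap add.commute)
qed

text \<open>
  The sign here is the one that the letters \<open>a\<close>, \<open>b\<close> contribute when they are put, in this order,
  in front of a word on \<open>A - {a, b}\<close>. It changes when \<open>a\<close> and \<open>b\<close> are exchanged, because
  \<open>rank A b\<close> counts the element \<open>a\<close> and \<open>rank (A - {a}) b\<close> does not, if \<open>a < b\<close>. Hence each
  unordered pair contributes a multiple of \<open>u - v\<close>.
\<close>

lemma alternating_sum_over_first_two:
  fixes u v :: "'a :: comm_ring_1"
  assumes "finite A"
  shows "(\<Sum>a\<in>A. \<Sum>b\<in>A - {a}. (- 1) ^ (rank A a + rank (A - {a}) b) * (if a < b then u else v))
      = of_nat (card A div 2) * (u - v)"
proof -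
  define g :: "int \<Rightarrow> int \<Rightarrow> 'a" where
    "g a b = (- 1) ^ (rank A a + rank (A - {a}) b) * (if a < b then u else v)" for a b
  have "g a b + g b a = - ((- 1) ^ (rank A a + rank A b)) * (u - v)"
    if "a \<in> A" "b \<in> A" "a < b" for a b
    using rank_remove [OF assms \<open>a \<in> A\<close>, of b] rank_remove [OF assms \<open>b \<in> A\<close>, of a] that
    by (simp add: g_def power_add algebra_simps)
  then have "(\<Sum>b\<in>A. \<Sum>a\<in>{a\<in>A. a < b}. g a b + g b a)
      = (\<Sum>b\<in>A. \<Sum>a\<in>{a\<in>A. a < b}. - ((- 1) ^ (rank A a + rank A b)) * (u - v))"
    by (intro sum.cong) auto
  also have "\<dots> = of_nat (card A div 2) * (u - v)"
    by (simp only: sum_distrib_right [symmetric] alternating_rank_sum_pairs [OF assms])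
  finally show ?thesis
    unfolding sum_ordered_pairs [OF assms, symmetric] by (simp add: g_def)
qed

section \<open>Signed words\<close>

definition signed_words :: "int set \<Rightarrow> int list set" where
  "signed_words A = {w. distinct (map abs w) \<and> abs ` set w = A}"

text \<open>The sign of the sequence of absolute values, \<open>-1\<close> to the number of its inversions.\<close>

fun abs_sign :: "int list \<Rightarrow> 'a :: comm_ring_1" where
  "abs_sign [] = 1"
| "abs_sign (p # w) = (- 1) ^ length (filter (\<lambda>q. \<bar>q\<bar> < \<bar>p\<bar>) w) * abs_sign w"

text \<open>
  The weight of a word that is cut into blocks of two letters from the left: \<open>Y i\<close> marks a descent
  in block \<open>i\<close>, counted from \<open>0\<close>, and \<open>t\<close> marks a negative first letter of a block. A last letter
  without partner counts as the first letter of a block.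
\<close>

fun pair_weight :: "'a :: comm_ring_1 \<Rightarrow> (nat \<Rightarrow> 'a) \<Rightarrow> int list \<Rightarrow> 'a" where
  "pair_weight t Y [] = 1"
| "pair_weight t Y [p] = (if p < 0 then t else 1)"
| "pair_weight t Y (p # q # w) =
     (if p < 0 then t else 1) * (if q < p then Y 0 else 1) * pair_weight t (\<lambda>i. Y (Suc i)) w"

lemma signed_words_empty: "signed_words {} = {[]}"
  by (auto simp: signed_words_def)

lemma length_signed_word: "w \<in> signed_words A \<Longrightarrow> length w = card A"
  unfolding signed_words_def using distinct_card [of "map abs w"] by auto

lemma finite_signed_words:
  assumes "finite A"
  shows "finite (signed_words A)"
proof (rule finite_subset)
  have "p \<in> A \<union> uminus ` A" if "\<bar>p\<bar> \<in> A" for p :: int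
    using that by (cases "p < 0") (auto intro: rev_image_eqI)
  then show "signed_words A \<subseteq> {w. set w \<subseteq> A \<union> uminus ` A \<and> length w = card A}"
    using length_signed_word by (force simp: signed_words_def)
  show "finite {w. set w \<subseteq> A \<union> uminus ` A \<and> length w = card A}"
    using assms by (intro finite_lists_length_eq) simp
qed

lemma Cons_in_signed_words:
  "p # w \<in> signed_words A \<longleftrightarrow> \<bar>p\<bar> \<in> A \<and> w \<in> signed_words (A - {\<bar>p\<bar>})"
  by (auto simp: signed_words_def rev_image_eqI)

lemma sum_signed_words_Cons:
  fixes F :: "int list \<Rightarrow> 'a :: comm_monoid_add"
  assumes fin: "finite A" and ne: "A \<noteq> {}" and pos: "\<forall>a\<in>A. 0 < a"
  shows "(\<Sum>w\<in>signed_words A. F w)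
      = (\<Sum>a\<in>A. \<Sum>w\<in>signed_words (A - {a}). F (a # w) + F (- a # w))"
proof -
  let ?L = "A \<union> uminus ` A"
  have letter: "p \<in> ?L \<longleftrightarrow> \<bar>p\<bar> \<in> A" for p
    using pos by (cases "p < 0") (auto simp: image_iff intro: bexI [of _ "- p"])
  have words: "signed_words A = (\<lambda>(p, w). p # w) ` (SIGMA p:?L. signed_words (A - {\<bar>p\<bar>}))"
  proof (intro equalityI subsetI)
    fix w assume w: "w \<in> signed_words A"
    then obtain p v where "w = p # v" using ne by (cases w) (auto simp: signed_words_def)
    with w show "w \<in> (\<lambda>(p, w). p # w) ` (SIGMA p:?L. signed_words (A - {\<bar>p\<bar>}))"
      by (intro rev_image_eqI [of "(p, v)"]) (simp_all only: mem_Sigma_iff letter Cons_in_signed_words split)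
  next
    fix w assume "w \<in> (\<lambda>(p, w). p # w) ` (SIGMA p:?L. signed_words (A - {\<bar>p\<bar>}))"
    then obtain p v where "w = p # v" "p \<in> ?L" "v \<in> signed_words (A - {\<bar>p\<bar>})" by (elim imageE SigmaE) auto
    then show "w \<in> signed_words A" by (simp only: Cons_in_signed_words letter)
  qed
  have "(\<Sum>w\<in>signed_words A. F w) = (\<Sum>(p, w)\<in>(SIGMA p:?L. signed_words (A - {\<bar>p\<bar>})). F (p # w))"
    unfolding words by (subst sum.reindex) (auto simp: inj_on_def case_prod_unfold)
  also have "\<dots> = (\<Sum>p\<in>?L. \<Sum>w\<in>signed_words (A - {\<bar>p\<bar>}). F (p # w))"
    using fin by (intro sum.Sigma [symmetric]) (auto simp: finite_signed_words)
  also have "\<dots> = (\<Sum>p\<in>A. \<Sum>w\<in>signed_words (A - {\<bar>p\<bar>}). F (p # w))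
      + (\<Sum>p\<in>uminus ` A. \<Sum>w\<in>signed_words (A - {\<bar>p\<bar>}). F (p # w))"
  proof (rule sum.union_disjoint)
    show "A \<inter> uminus ` A = {}"
    proof (rule equals0I)
      fix p assume "p \<in> A \<inter> uminus ` A"
      then have "0 < p" "p < 0" using pos by auto
      then show False by simp
    qed
  qed (use fin in auto)
  also have "(\<Sum>p\<in>uminus ` A. \<Sum>w\<in>signed_words (A - {\<bar>p\<bar>}). F (p # w))
      = (\<Sum>a\<in>A. \<Sum>w\<in>signed_words (A - {\<bar>a\<bar>}). F (- a # w))"
    by (subst sum.reindex) (auto simp: inj_on_def)
  also have "(\<Sum>p\<in>A. \<Sum>w\<in>signed_words (A - {\<bar>p\<bar>}). F (p # w)) + \<dots>
      = (\<Sum>a\<in>A. \<Sum>w\<in>signed_words (A - {a}). F (a # w) + F (- a # w))"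
    using pos by (simp add: sum.distrib [symmetric] abs_of_pos)
  finally show ?thesis .
qed

text \<open>Every element of \<open>A\<close> other than \<open>\<bar>p\<bar>\<close> occurs later, so \<open>p\<close> takes part in \<open>rank A \<bar>p\<bar>\<close> inversions.\<close>

lemma abs_sign_Cons:
  assumes "w \<in> signed_words (A - {\<bar>p\<bar>})"
  shows "abs_sign (p # w) = (- 1 :: 'a :: comm_ring_1) ^ rank A \<bar>p\<bar> * abs_sign w"
proof -
  have w: "distinct (map abs w)" "abs ` set w = A - {\<bar>p\<bar>}"
    using assms by (auto simp: signed_words_def)
  have "length (filter (\<lambda>q. \<bar>q\<bar> < \<bar>p\<bar>) w) = length (filter (\<lambda>c. c < \<bar>p\<bar>) (map abs w))"
    by (simp add: filter_map o_def)
  also have "\<dots> = card (set (filter (\<lambda>c. c < \<bar>p\<bar>) (map abs w)))"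
    using w(1) distinct_filter distinct_card by metis
  also have "set (filter (\<lambda>c. c < \<bar>p\<bar>) (map abs w)) = {c \<in> A. c < \<bar>p\<bar>}"
    using w(2) by auto
  finally show ?thesis by (simp add: rank_def)
qed

lemma sum_abs_sign_Cons:
  fixes F :: "int list \<Rightarrow> 'a :: comm_ring_1"
  assumes "finite A" "A \<noteq> {}" and pos: "\<forall>a\<in>A. 0 < a"
  shows "(\<Sum>w\<in>signed_words A. abs_sign w * F w)
      = (\<Sum>a\<in>A. (- 1) ^ rank A a * (\<Sum>w\<in>signed_words (A - {a}). abs_sign w * (F (a # w) + F (- a # w))))"
  unfolding sum_signed_words_Cons [OF assms] sum_distrib_left
proof (intro sum.cong refl)
  fix a w assume "a \<in> A" and w: "w \<in> signed_words (A - {a})"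
  then have "\<bar>a\<bar> = a" using pos by auto
  then have "abs_sign (a # w) = (- 1 :: 'a) ^ rank A a * abs_sign w"
      and "abs_sign (- a # w) = (- 1 :: 'a) ^ rank A a * abs_sign w"
    using abs_sign_Cons [of w A a] abs_sign_Cons [of w A "- a"] w by simp_all
  then show "abs_sign (a # w) * F (a # w) + abs_sign (- a # w) * F (- a # w)
      = (- 1) ^ rank A a * (abs_sign w * (F (a # w) + F (- a # w)))"
    by (simp only: algebra_simps)
qed

text \<open>
  The signs of the first two letters matter only within their own block. A descent at absolute
  values \<open>a < b\<close> means that \<open>b\<close> carries a minus sign, independently of the sign of \<open>a\<close>, and the sum
  factors as \<open>(1 + t) (1 + Y 0)\<close>; at \<open>a > b\<close> it means that \<open>a\<close> is positive, so that every word
  has exactly one of the factors \<open>t\<close> and \<open>Y 0\<close>.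
\<close>

lemma pair_weight_sum_over_signs:
  assumes "0 < a" "0 < b" "a \<noteq> b"
  shows "pair_weight t Y (a # b # w) + pair_weight t Y (- a # b # w)
       + (pair_weight t Y (a # - b # w) + pair_weight t Y (- a # - b # w))
     = (if a < b then 1 + t + Y 0 + t * Y 0 else 2 * t + 2 * Y 0)
       * pair_weight t (\<lambda>i. Y (Suc i)) w"
  using assms by (auto simp: algebra_simps)

text \<open>
  Splitting off the first block \<open>(\<plusminus>a, \<plusminus>b)\<close> leaves a word on \<open>A - {a, b}\<close>, whose sum \<open>G\<close> is
  the same for all \<open>a\<close> and \<open>b\<close> by induction. The sum over the first block is then a case of
  \<open>alternating_sum_over_first_two\<close>.
\<close>

lemma signed_sum_pair_weight:
  assumes "finite A" "\<forall>a\<in>A. 0 < a"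
  shows "(\<Sum>w\<in>signed_words A. abs_sign w * pair_weight t Y w)
    = of_nat (fact (card A div 2)) * (1 + t) ^ (card A mod 2) * (1 - t) ^ (card A div 2)
      * (\<Prod>i<card A div 2. 1 - Y i)"
  using assms
proof (induction "card A" arbitrary: A Y rule: less_induct)
  case less
  consider "card A = 0" | "card A = 1" | "card A \<ge> 2" by linarith
  then show ?case
  proof cases
    case 1
    then show ?thesis using less.prems by (simp add: signed_words_empty)
  next
    case 2
    then obtain a where "A = {a}" using card_1_singletonE by blast
    moreover have "rank {a} a = 0" using rank_insert_greater(2) [of "{}" a] by simp
    ultimately show ?thesis
      using less.prems by (simp add: sum_abs_sign_Cons signed_words_empty)
  next
    case 3
    define m where "m = card A div 2 - 1"
    have m: "card A div 2 = Suc m" "(card A - 2) div 2 = m" "(card A - 2) mod 2 = card A mod 2"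
      using 3 by (auto simp: m_def le_mod_geq)
    have "A \<noteq> {}" using 3 by auto
    define G where "G = of_nat (fact m) * (1 + t) ^ (card A mod 2) * (1 - t) ^ m
      * (\<Prod>i<m. 1 - Y (Suc i))"
    define u where "u = 1 + t + Y 0 + t * Y 0"
    define v where "v = 2 * t + 2 * Y 0"
    have rest: "(\<Sum>w\<in>signed_words (A - {a} - {b}). abs_sign w * pair_weight t (\<lambda>i. Y (Suc i)) w) = G"
      if "a \<in> A" "b \<in> A - {a}" for a b
    proof -
      have card: "card (A - {a} - {b}) = card A - 2"
        using that less.prems by (simp add: card_Diff_singleton)
      have "(\<Sum>w\<in>signed_words (A - {a} - {b}). abs_sign w * pair_weight t (\<lambda>i. Y (Suc i)) w)
        = of_nat (fact ((card A - 2) div 2)) * (1 + t) ^ ((card A - 2) mod 2)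
          * (1 - t) ^ ((card A - 2) div 2) * (\<Prod>i<(card A - 2) div 2. 1 - Y (Suc i))"
        using less.hyps [of "A - {a} - {b}" "\<lambda>i. Y (Suc i)"] less.prems 3 unfolding card by auto
      then show ?thesis by (simp only: m G_def)
    qed
    have pair: "(\<Sum>w\<in>signed_words (A - {a}). abs_sign w * (pair_weight t Y (a # w) + pair_weight t Y (- a # w)))
        = (\<Sum>b\<in>A - {a}. (- 1) ^ rank (A - {a}) b * (if a < b then u else v) * G)"
      if "a \<in> A" for a
    proof -
      have "A - {a} \<noteq> {}"
      proof
        assume "A - {a} = {}"
        then have "A = {a}" using that by auto
        then show False using 3 by simp
      qed
      then have "(\<Sum>w\<in>signed_words (A - {a}). abs_sign w * (pair_weight t Y (a # w) + pair_weight t Y (- a # w)))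
        = (\<Sum>b\<in>A - {a}. (- 1) ^ rank (A - {a}) b *
            (\<Sum>w\<in>signed_words (A - {a} - {b}). abs_sign w *
              (pair_weight t Y (a # b # w) + pair_weight t Y (- a # b # w)
               + (pair_weight t Y (a # - b # w) + pair_weight t Y (- a # - b # w)))))"
        using less.prems by (subst sum_abs_sign_Cons) auto
      also have "\<dots> = (\<Sum>b\<in>A - {a}. (- 1) ^ rank (A - {a}) b * ((if a < b then u else v) * G))"
      proof (rule sum.cong [OF refl])
        fix b assume b: "b \<in> A - {a}"
        then have ab: "0 < a" "0 < b" "a \<noteq> b" using that less.prems by auto
        show "(- 1) ^ rank (A - {a}) b *
            (\<Sum>w\<in>signed_words (A - {a} - {b}). abs_sign w *
              (pair_weight t Y (a # b # w) + pair_weight t Y (- a # b # w)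
               + (pair_weight t Y (a # - b # w) + pair_weight t Y (- a # - b # w))))
          = (- 1) ^ rank (A - {a}) b * ((if a < b then u else v) * G)"
          unfolding rest [OF that b, symmetric] pair_weight_sum_over_signs [OF ab] u_def v_def
            sum_distrib_left
          by (intro sum.cong refl) (simp only: ac_simps)
      qed
      finally show ?thesis by (simp only: mult.assoc)
    qed
    have "(\<Sum>w\<in>signed_words A. abs_sign w * pair_weight t Y w)
      = (\<Sum>a\<in>A. (- 1) ^ rank A a * (\<Sum>b\<in>A - {a}. (- 1) ^ rank (A - {a}) b * (if a < b then u else v) * G))"
      unfolding sum_abs_sign_Cons [OF less.prems(1) \<open>A \<noteq> {}\<close> less.prems(2)]
      by (intro sum.cong refl) (simp only: pair)
    also have "\<dots> = (\<Sum>a\<in>A. \<Sum>b\<in>A - {a}. (- 1) ^ (rank A a + rank (A - {a}) b) * (if a < b then u else v)) * G"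
      by (simp only: sum_distrib_left sum_distrib_right power_add mult.assoc)
    also have "\<dots> = of_nat (Suc m) * (u - v) * G"
      using less.prems by (simp only: alternating_sum_over_first_two m)
    also have "u - v = (1 - t) * (1 - Y 0)"
      by (simp add: u_def v_def algebra_simps)
    also have "of_nat (Suc m) * \<dots> * G
      = of_nat (fact (Suc m)) * (1 + t) ^ (card A mod 2) * (1 - t) ^ Suc m
        * (\<Prod>i<Suc m. 1 - Y i)"
      unfolding G_def prod.lessThan_Suc_shift fact_Suc of_nat_mult power_Suc of_nat_id
      by (simp only: ac_simps)
    finally show ?thesis by (simp only: m)
  qed
qed

lemma signed_sum_pair_weight_tl:
  assumes fin: "finite A" and ne: "A \<noteq> {}" and pos: "\<forall>a\<in>A. 0 < a"
  shows "(\<Sum>w\<in>signed_words A. abs_sign w * ((if hd w < 0 then y else 1) * pair_weight t Y (tl w)))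
    = of_nat (card A mod 2) * of_nat (fact (card A div 2)) * (1 + y) * (1 - t) ^ (card A div 2)
      * (\<Prod>i<card A div 2. 1 - Y i)"
proof -
  \<comment> \<open>What \<open>signed_sum_pair_weight\<close> gives for the words that can follow the first letter, \<open>m\<close> being their length.\<close>
  define H where "H m = of_nat (fact (m div 2)) * (1 + t) ^ (m mod 2) * (1 - t) ^ (m div 2)
      * (\<Prod>i<m div 2. 1 - Y i)" for m :: nat
  have "(\<Sum>w\<in>signed_words (A - {a}). abs_sign w *
          ((if hd (a # w) < 0 then y else 1) * pair_weight t Y (tl (a # w))
           + (if hd (- a # w) < 0 then y else 1) * pair_weight t Y (tl (- a # w))))
      = (1 + y) * H (card A - 1)" if "a \<in> A" for a
  proof -
    have "0 < a" using that pos by auto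
    then have "(\<Sum>w\<in>signed_words (A - {a}). abs_sign w *
          ((if hd (a # w) < 0 then y else 1) * pair_weight t Y (tl (a # w))
           + (if hd (- a # w) < 0 then y else 1) * pair_weight t Y (tl (- a # w))))
       = (1 + y) * (\<Sum>w\<in>signed_words (A - {a}). abs_sign w * pair_weight t Y w)"
      unfolding sum_distrib_left by (intro sum.cong) (auto simp: algebra_simps)
    also have "(\<Sum>w\<in>signed_words (A - {a}). abs_sign w * pair_weight t Y w) = H (card A - 1)"
      using fin pos that by (subst signed_sum_pair_weight) (auto simp: H_def card_Diff_singleton)
    finally show ?thesis .
  qed
  then have "(\<Sum>w\<in>signed_words A. abs_sign w * ((if hd w < 0 then y else 1) * pair_weight t Y (tl w)))
      = (\<Sum>a\<in>A. (- 1) ^ rank A a) * ((1 + y) * H (card A - 1))"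
    unfolding sum_abs_sign_Cons [OF assms] sum_distrib_right by (intro sum.cong refl) simp
  also have "\<dots> = of_nat (card A mod 2) * ((1 + y) * H (card A - 1))"
    by (simp only: alternating_rank_sum fin)
  also have "\<dots> = of_nat (card A mod 2) * of_nat (fact (card A div 2)) * (1 + y) * (1 - t) ^ (card A div 2)
      * (\<Prod>i<card A div 2. 1 - Y i)"
  proof (cases "even (card A)")
    case False
    then have "(card A - 1) div 2 = card A div 2" "(card A - 1) mod 2 = 0" by presburger+
    then show ?thesis by (simp only: H_def power_0) (simp add: ac_simps)
  qed simp
  finally show ?thesis .
qed

section \<open>Signed permutations as signed words\<close>

definition word_of :: "nat \<Rightarrow> (int \<Rightarrow> int) \<Rightarrow> int list" where
  "word_of n \<sigma> = map (\<lambda>i. \<sigma> (int i)) [1..<Suc n]"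

lemma signed_perm_uminus:
  assumes "\<sigma> \<in> signed_perms n"
  shows "\<sigma> (- i) = - \<sigma> i"
proof (cases "i \<in> {- int n..int n} - {0}")
  case False
  then have "- i \<notin> {- int n..int n} - {0}" by auto
  then show ?thesis
    using False assms permutes_not_in [of \<sigma>] unfolding signed_perms_def mem_Collect_eq by metis
qed (use assms in \<open>auto simp: signed_perms_def\<close>)

lemma abs_signed_perm:
  assumes "\<sigma> \<in> signed_perms n"
  shows "bij_betw (\<lambda>i. \<bar>\<sigma> (int i)\<bar>) {1..n} {1..int n}"
proof -
  let ?S = "{- int n..int n} - {0}"
  have perm: "\<sigma> permutes ?S" using assms by (simp add: signed_perms_def)
  have inj: "inj \<sigma>" using permutes_inj [OF perm] .
  have "inj_on (\<lambda>i. \<bar>\<sigma> (int i)\<bar>) {1..n}"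
  proof (rule inj_onI)
    fix i j assume ij: "i \<in> {1..n}" "j \<in> {1..n}" and eq: "\<bar>\<sigma> (int i)\<bar> = \<bar>\<sigma> (int j)\<bar>"
    from eq have "\<sigma> (int i) = \<sigma> (int j) \<or> \<sigma> (int i) = \<sigma> (- int j)"
      using signed_perm_uminus [OF assms, of "int j"] by (simp add: abs_eq_iff)
    then have "int i = int j \<or> int i = - int j" by (simp only: inj_eq [OF inj])
    then show "i = j" using ij by auto
  qed
  moreover have "(\<lambda>i. \<bar>\<sigma> (int i)\<bar>) ` {1..n} \<subseteq> {1..int n}"
  proof (rule image_subsetI)
    fix i assume "i \<in> {1..n}"
    then have "int i \<in> ?S" by auto
    then have "\<sigma> (int i) \<in> ?S" using permutes_in_image [OF perm] by blast
    then show "\<bar>\<sigma> (int i)\<bar> \<in> {1..int n}" by auto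
  qed
  moreover from this calculation(1) have "(\<lambda>i. \<bar>\<sigma> (int i)\<bar>) ` {1..n} = {1..int n}"
    by (intro card_subset_eq) (auto simp: card_image)
  ultimately show ?thesis by (simp add: bij_betw_def)
qed

lemma word_of_in_signed_words:
  assumes "\<sigma> \<in> signed_perms n"
  shows "word_of n \<sigma> \<in> signed_words {1..int n}"
proof -
  have "map abs (word_of n \<sigma>) = map (\<lambda>i. \<bar>\<sigma> (int i)\<bar>) [1..<Suc n]"
    by (simp add: word_of_def)
  moreover have "distinct (map (\<lambda>i. \<bar>\<sigma> (int i)\<bar>) [1..<Suc n])"
      "set (map (\<lambda>i. \<bar>\<sigma> (int i)\<bar>) [1..<Suc n]) = {1..int n}"
    using abs_signed_perm [OF assms]
    by (simp_all only: distinct_map set_map set_upt distinct_upt bij_betw_def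
        atLeastLessThanSuc_atLeastAtMost simp_thms)
  ultimately show ?thesis
    unfolding signed_words_def mem_Collect_eq set_map [symmetric] by simp
qed

lemma word_of_bij: "bij_betw (word_of n) (signed_perms n) (signed_words {1..int n})"
proof (rule bij_betw_imageI)
  let ?S = "{- int n..int n} - {0}"
  show "inj_on (word_of n) (signed_perms n)"
  proof (rule inj_onI, rule ext)
    fix \<sigma> \<tau> i assume st: "\<sigma> \<in> signed_perms n" "\<tau> \<in> signed_perms n" and eq: "word_of n \<sigma> = word_of n \<tau>"
    have nat_eq: "\<sigma> (int k) = \<tau> (int k)" if "k \<in> {1..n}" for k
      using arg_cong [OF eq, of "\<lambda>w. w ! (k - 1)"] that
      unfolding word_of_def by (subst (asm) (1 2) nth_map_upt) auto
    show "\<sigma> i = \<tau> i"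
    proof (cases "i \<in> ?S")
      case True
      then have "nat \<bar>i\<bar> \<in> {1..n}" by auto
      then have "\<sigma> \<bar>i\<bar> = \<tau> \<bar>i\<bar>" using nat_eq [of "nat \<bar>i\<bar>"] by simp
      then show ?thesis
        using signed_perm_uminus [OF st(1), of i] signed_perm_uminus [OF st(2), of i]
        by (cases "i < 0") auto
    next
      case False
      then show ?thesis using st permutes_not_in unfolding signed_perms_def mem_Collect_eq by metis
    qed
  qed
  show "word_of n ` signed_perms n = signed_words {1..int n}"
  proof (intro equalityI subsetI)
    fix w assume w: "w \<in> signed_words {1..int n}"
    \<comment> \<open>The odd extension of the word, whose index starts at \<open>0\<close> rather than \<open>1\<close>.\<close>
    define \<sigma> where "\<sigma> i = (if i \<in> ?S then sgn i * w ! nat (\<bar>i\<bar> - 1) else i)" for i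
    have outside: "\<sigma> i = i" if "i \<notin> ?S" for i
      unfolding \<sigma>_def using that by (rule if_not_P)
    have len: "length w = n" using length_signed_word [OF w] by simp
    have letter: "\<bar>w ! k\<bar> \<in> {1..int n}" if "k < n" for k
      using w that len by (auto simp: signed_words_def)
    have abs_\<sigma>: "\<bar>\<sigma> i\<bar> = \<bar>w ! nat (\<bar>i\<bar> - 1)\<bar>" if "i \<in> ?S" for i
      using that by (simp add: \<sigma>_def abs_mult)
    have into: "\<sigma> ` ?S \<subseteq> ?S"
    proof (rule image_subsetI)
      fix i assume i: "i \<in> ?S"
      then have "\<bar>\<sigma> i\<bar> \<in> {1..int n}" using letter [of "nat (\<bar>i\<bar> - 1)"] abs_\<sigma> [OF i] by auto
      then show "\<sigma> i \<in> ?S" by auto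
    qed
    have odd: "\<sigma> (- i) = - \<sigma> i" if "i \<in> ?S" for i
      using that by (auto simp: \<sigma>_def)
    have "inj_on \<sigma> ?S"
    proof (rule inj_onI)
      fix i j assume ij: "i \<in> ?S" "j \<in> ?S" and eq: "\<sigma> i = \<sigma> j"
      have "nat (\<bar>i\<bar> - 1) < length w" "nat (\<bar>j\<bar> - 1) < length w" using ij len by auto
      then have "map abs w ! nat (\<bar>i\<bar> - 1) = map abs w ! nat (\<bar>j\<bar> - 1)"
        using abs_\<sigma> [OF ij(1)] abs_\<sigma> [OF ij(2)] eq by simp
      moreover have "distinct (map abs w)" using w by (simp add: signed_words_def)
      moreover have "nat (\<bar>i\<bar> - 1) < n" "nat (\<bar>j\<bar> - 1) < n" using ij by auto
      ultimately have "nat (\<bar>i\<bar> - 1) = nat (\<bar>j\<bar> - 1)"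
        using nth_eq_iff_index_eq [of "map abs w"] len by simp
      then have "\<bar>i\<bar> = \<bar>j\<bar>" using ij by auto
      moreover have "i \<noteq> - j"
      proof
        assume "i = - j"
        then have "\<sigma> j = 0" using eq odd [OF ij(2)] by simp
        then show False using into ij(2) by force
      qed
      ultimately show "i = j" by (auto simp: abs_eq_iff)
    qed
    then have "bij_betw \<sigma> ?S ?S"
      using into by (simp add: bij_betw_def endo_inj_surj)
    then have "\<sigma> permutes ?S" by (rule bij_imp_permutes) (rule outside)
    then have "\<sigma> \<in> signed_perms n" using odd by (simp add: signed_perms_def)
    moreover have "word_of n \<sigma> = w"
      by (rule nth_equalityI) (auto simp: word_of_def \<sigma>_def len nth_append simp del: upt_Suc)
    ultimately show "w \<in> word_of n ` signed_perms n" by blast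
  qed (auto simp: word_of_in_signed_words)
qed

section \<open>The sign\<close>

lemma neg_one_power_card:
  assumes "finite A"
  shows "(- 1 :: 'a :: comm_ring_1) ^ card {j \<in> A. P j} = (\<Prod>j\<in>A. if P j then - 1 else 1)"
  using assms by (simp add: prod.If_cases Int_def conj_commute)

lemma neg_one_power_length_filter:
  "(- 1 :: 'a :: comm_ring_1) ^ length (filter P (map f [k..<m]))
    = (\<Prod>j\<in>{k..<m}. if P (f j) then - 1 else 1)"
proof -
  have "length (filter P (map f [k..<m])) = card {j \<in> {k..<m}. P (f j)}"
    by (simp add: filter_map distinct_card [symmetric] o_def conj_commute)
  then show ?thesis by (simp only: neg_one_power_card finite_atLeastLessThan)
qed

lemma abs_sign_eq_prod:
  "abs_sign (map f [k..<m])
    = (\<Prod>i\<in>{k..<m}. \<Prod>j\<in>{Suc i..<m}. if \<bar>f j\<bar> < \<bar>f i\<bar> then - 1 else (1 :: 'a :: comm_ring_1))"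
proof (induction "m - k" arbitrary: k)
  case (Suc d)
  then have "k < m" "d = m - Suc k" by auto
  then show ?case
    using Suc.hyps(1) [of "Suc k"]
    by (simp add: upt_conv_Cons prod.atLeast_Suc_lessThan neg_one_power_length_filter del: length_filter_map filter_map map_map)
qed simp

lemma prod_square_split:
  fixes h :: "nat \<Rightarrow> nat \<Rightarrow> 'a :: comm_monoid_mult"
  shows "(\<Prod>i\<in>{k..<m}. \<Prod>j\<in>{k..<m}. h i j)
    = (\<Prod>i\<in>{k..<m}. h i i * (\<Prod>j\<in>{Suc i..<m}. h i j * h j i))"
proof (induction "m - k" arbitrary: k)
  case (Suc d)
  then have "k < m" "d = m - Suc k" by auto
  then show ?case
    using Suc.hyps(1) [of "Suc k"]
    by (simp add: prod.atLeast_Suc_lessThan prod.distrib ac_simps)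
qed simp

text \<open>
  A negative value \<open>\<sigma> i\<close> contributes \<open>\<bar>\<sigma> i\<bar> + 1\<close> to the exponent. Modulo \<open>2\<close> this is \<open>\<bar>\<sigma> i\<bar> - 1\<close>,
  the number of positions \<open>j\<close> with \<open>\<bar>\<sigma> j\<bar> < \<bar>\<sigma> i\<bar>\<close>, so the whole exponent becomes a count over
  pairs \<open>i < j\<close>. If \<open>\<bar>\<sigma> i\<bar> > \<bar>\<sigma> j\<bar>\<close>, then either \<open>\<sigma> i\<close> is positive and the pair is an inversion
  of \<open>\<sigma>\<close>, or \<open>\<sigma> i\<close> is negative and the pair is counted for \<open>i\<close>: once in both cases. If
  \<open>\<bar>\<sigma> i\<bar> < \<bar>\<sigma> j\<bar>\<close>, it is counted twice (as an inversion and for \<open>j\<close>) or never, according to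
  the sign of \<open>\<sigma> j\<close>.
\<close>

lemma neg_one_power_length_B:
  assumes "\<sigma> \<in> signed_perms n"
  shows "(- 1 :: 'a :: comm_ring_1) ^ (length_B n \<sigma> + neg n \<sigma>) = abs_sign (word_of n \<sigma>)"
proof -
  define f where "f i = \<sigma> (int i)" for i
  define I where "I = {1..<Suc n}"
  define s :: "bool \<Rightarrow> 'a" where "s P = (if P then - 1 else 1)" for P
  have bij: "bij_betw (\<lambda>i. \<bar>f i\<bar>) I {1..int n}"
    using abs_signed_perm [OF assms] by (simp add: f_def I_def atLeastLessThanSuc_atLeastAtMost)
  have abs_f: "\<bar>f i\<bar> \<in> {1..int n}" if "i \<in> I" for i
    using bij that by (auto simp: bij_betw_def)
  have nat_pred: "nat a = Suc (nat (a - 1))" if "1 \<le> a" for a :: int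
    using that by linarith
  \<comment> \<open>The absolute values fill \<open>{1..n}\<close>, so each one is determined by the number of smaller ones.\<close>
  have rank: "nat \<bar>f i\<bar> = Suc (card {j \<in> I. \<bar>f j\<bar> < \<bar>f i\<bar>})" if "i \<in> I" for i
  proof -
    have "(\<lambda>i. \<bar>f i\<bar>) ` {j \<in> I. \<bar>f j\<bar> < \<bar>f i\<bar>} = {c \<in> (\<lambda>i. \<bar>f i\<bar>) ` I. c < \<bar>f i\<bar>}" by auto
    also have "\<dots> = {1..<\<bar>f i\<bar>}" using bij abs_f [OF that] by (auto simp: bij_betw_def)
    finally have im: "(\<lambda>i. \<bar>f i\<bar>) ` {j \<in> I. \<bar>f j\<bar> < \<bar>f i\<bar>} = {1..<\<bar>f i\<bar>}" .
    have "inj_on (\<lambda>i. \<bar>f i\<bar>) {j \<in> I. \<bar>f j\<bar> < \<bar>f i\<bar>}"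
      using bij by (auto simp: bij_betw_def inj_on_def)
    then have "card {j \<in> I. \<bar>f j\<bar> < \<bar>f i\<bar>} = card {1..<\<bar>f i\<bar>}"
      by (simp add: card_image flip: im)
    then show ?thesis using abs_f [OF that] by (simp add: nat_pred)
  qed
  have Neg: "Neg n \<sigma> = {i \<in> I. f i < 0}"
    by (auto simp: Neg_def I_def f_def)
  define inv where "inv = card {(i, j). 1 \<le> i \<and> i < j \<and> j \<le> n \<and> \<sigma> (int i) > \<sigma> (int j)}"
  have "int (length_B n \<sigma>) = int inv + (\<Sum>i\<in>Neg n \<sigma>. int (nat \<bar>f i\<bar>))"
    unfolding int_length_B inv_def
    by (simp add: sum_negf [symmetric]) (auto simp: f_def Neg_def intro!: sum.cong)
  then have "int (length_B n \<sigma>) = int (inv + (\<Sum>i\<in>Neg n \<sigma>. nat \<bar>f i\<bar>))"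
    by simp
  then have "length_B n \<sigma> = inv + (\<Sum>i\<in>Neg n \<sigma>. nat \<bar>f i\<bar>)"
    by (simp only: of_nat_eq_iff)
  then have "length_B n \<sigma> + neg n \<sigma> = inv + (\<Sum>i\<in>Neg n \<sigma>. Suc (nat \<bar>f i\<bar>))"
    unfolding neg_def by (simp add: sum_Suc)
  then have len: "(- 1 :: 'a) ^ (length_B n \<sigma> + neg n \<sigma>)
      = (- 1) ^ inv * (\<Prod>i\<in>Neg n \<sigma>. (- 1) ^ Suc (nat \<bar>f i\<bar>))"
    by (simp only: power_add power_sum)
  have "(\<Prod>i\<in>Neg n \<sigma>. (- 1 :: 'a) ^ Suc (nat \<bar>f i\<bar>))
      = (\<Prod>i\<in>Neg n \<sigma>. \<Prod>j\<in>I. s (\<bar>f j\<bar> < \<bar>f i\<bar>))"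
  proof (rule prod.cong [OF refl])
    fix i assume "i \<in> Neg n \<sigma>"
    then have "i \<in> I" by (simp add: Neg)
    then have "(- 1 :: 'a) ^ Suc (nat \<bar>f i\<bar>) = (- 1) ^ card {j \<in> I. \<bar>f j\<bar> < \<bar>f i\<bar>}"
      by (simp only: rank power_Suc) simp
    then show "(- 1 :: 'a) ^ Suc (nat \<bar>f i\<bar>) = (\<Prod>j\<in>I. s (\<bar>f j\<bar> < \<bar>f i\<bar>))"
      unfolding s_def by (simp only: neg_one_power_card I_def finite_atLeastLessThan)
  qed
  also have "\<dots> = (\<Prod>i\<in>I. \<Prod>j\<in>I. s (f i < 0 \<and> \<bar>f j\<bar> < \<bar>f i\<bar>))"
  proof -
    have "finite I" by (simp add: I_def)
    then show ?thesis
      unfolding Neg by (subst prod.inter_filter) (auto simp: s_def intro!: prod.cong)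
  qed
  also have "\<dots> = (\<Prod>i\<in>I. \<Prod>j\<in>{Suc i..<Suc n}.
      s (f i < 0 \<and> \<bar>f j\<bar> < \<bar>f i\<bar>) * s (f j < 0 \<and> \<bar>f i\<bar> < \<bar>f j\<bar>))"
    unfolding I_def by (subst prod_square_split) (simp add: s_def)
  finally have negs: "(\<Prod>i\<in>Neg n \<sigma>. (- 1 :: 'a) ^ Suc (nat \<bar>f i\<bar>)) = \<dots>" .
  have "{(i, j). 1 \<le> i \<and> i < j \<and> j \<le> n \<and> \<sigma> (int i) > \<sigma> (int j)}
      = (SIGMA i:I. {j \<in> {Suc i..<Suc n}. f j < f i})"
    by (auto simp: I_def f_def)
  then have "inv = (\<Sum>i\<in>I. card {j \<in> {Suc i..<Suc n}. f j < f i})"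
    by (simp add: inv_def I_def)
  then have invs: "(- 1 :: 'a) ^ inv = (\<Prod>i\<in>I. \<Prod>j\<in>{Suc i..<Suc n}. s (f j < f i))"
    by (simp only: power_sum neg_one_power_card s_def finite_atLeastLessThan)
  have "(- 1 :: 'a) ^ (length_B n \<sigma> + neg n \<sigma>) = (\<Prod>i\<in>I. \<Prod>j\<in>{Suc i..<Suc n}. s (f j < f i)
      * (s (f i < 0 \<and> \<bar>f j\<bar> < \<bar>f i\<bar>) * s (f j < 0 \<and> \<bar>f i\<bar> < \<bar>f j\<bar>)))"
    by (simp only: len negs invs prod.distrib)
  also have "\<dots> = (\<Prod>i\<in>I. \<Prod>j\<in>{Suc i..<Suc n}. s (\<bar>f j\<bar> < \<bar>f i\<bar>))"
  proof (intro prod.cong refl)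
    fix i j assume ij: "i \<in> I" "j \<in> {Suc i..<Suc n}"
    then have "\<bar>f i\<bar> \<noteq> \<bar>f j\<bar>"
      using bij_betw_imp_inj_on [OF bij] by (auto dest!: inj_onD [of _ _ i j] simp: I_def)
    then show "s (f j < f i) * (s (f i < 0 \<and> \<bar>f j\<bar> < \<bar>f i\<bar>) * s (f j < 0 \<and> \<bar>f i\<bar> < \<bar>f j\<bar>))
        = s (\<bar>f j\<bar> < \<bar>f i\<bar>)"
      unfolding s_def by (auto split: if_splits)
  qed
  also have "\<dots> = abs_sign (word_of n \<sigma>)"
    unfolding word_of_def abs_sign_eq_prod I_def s_def f_def ..
  finally show ?thesis .
qed

section \<open>The statistics\<close>

text \<open>
  The lower bound \<open>k\<close> makes one formula serve both parities: the blocks start at the positions of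
  the same parity as \<open>k\<close>, which is \<open>1\<close> for the odd and \<open>2\<close> for the even statistics.
\<close>

lemma pair_weight_eq_prod:
  "pair_weight t Y (map f [k..<m])
    = (\<Prod>i\<in>{k..<m}. if even (i + k) then (if f i < 0 then t else 1) *
         (if Suc i < m \<and> f (Suc i) < f i then Y ((i - k) div 2) else 1) else 1)"
proof (induction "m - k" arbitrary: k Y rule: less_induct)
  case less
  consider "m \<le> k" | "m = Suc k" | "Suc k < m" by linarith
  then show ?case
  proof cases
    case 3
    define g where "g i = (if f i < 0 then t else 1) *
         (if Suc i < m \<and> f (Suc i) < f i then Y ((i - k) div 2) else 1)" for i
    have "[k..<m] = k # Suc k # [Suc (Suc k)..<m]"
      using 3 by (simp add: upt_conv_Cons)
    then have "pair_weight t Y (map f [k..<m])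
        = g k * pair_weight t (\<lambda>i. Y (Suc i)) (map f [Suc (Suc k)..<m])"
      using 3 by (simp add: g_def)
    also have "pair_weight t (\<lambda>i. Y (Suc i)) (map f [Suc (Suc k)..<m])
        = (\<Prod>i\<in>{Suc (Suc k)..<m}. if even (i + k) then g i else 1)"
    proof (subst less.hyps)
      show "(\<Prod>i\<in>{Suc (Suc k)..<m}. if even (i + Suc (Suc k)) then (if f i < 0 then t else 1) *
         (if Suc i < m \<and> f (Suc i) < f i then Y (Suc ((i - Suc (Suc k)) div 2)) else 1) else 1)
        = (\<Prod>i\<in>{Suc (Suc k)..<m}. if even (i + k) then g i else 1)"
      proof (intro prod.cong refl)
        fix i assume "i \<in> {Suc (Suc k)..<m}"
        then have "Suc ((i - Suc (Suc k)) div 2) = (i - k) div 2" by auto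
        then show "(if even (i + Suc (Suc k)) then (if f i < 0 then t else 1) *
         (if Suc i < m \<and> f (Suc i) < f i then Y (Suc ((i - Suc (Suc k)) div 2)) else 1) else 1)
         = (if even (i + k) then g i else 1)"
          by (simp add: g_def)
      qed
    qed (use 3 in simp)
    also have "g k * \<dots> = (\<Prod>i\<in>{k..<m}. if even (i + k) then g i else 1)"
      using 3 by (simp add: prod.atLeast_Suc_lessThan)
    finally show ?thesis by (simp only: g_def)
  qed simp_all
qed

lemma odd_statistics:
  fixes x y z :: "'a :: comm_ring_1"
  shows "x ^ ofmaj n \<sigma> * y ^ odes n \<sigma> * z ^ oneg n \<sigma>
    = pair_weight (x * z) (\<lambda>i. y * x ^ (2 * Suc i)) (word_of n \<sigma>)"
proof -
  have D: "odd_part (Des n \<sigma>) = {i \<in> {1..<Suc n}. odd i \<and> Suc i < Suc n \<and> \<sigma> (int (Suc i)) < \<sigma> (int i)}"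
    by (auto simp: odd_part_def Des_def elim: oddE)
  have N: "odd_part (Neg n \<sigma>) = {i \<in> {1..<Suc n}. odd i \<and> \<sigma> (int i) < 0}"
    by (auto simp: odd_part_def Neg_def)
  have "x ^ ofmaj n \<sigma> * y ^ odes n \<sigma> * z ^ oneg n \<sigma>
      = (\<Prod>i\<in>odd_part (Neg n \<sigma>). x * z)
        * (\<Prod>i\<in>odd_part (Des n \<sigma>). y * x ^ (2 * ((i + 1) div 2)))"
    by (simp add: ofmaj_def omaj_def odes_def oneg_def power_add power_mult power_sum
        power_mult_distrib prod.distrib ac_simps)
  also have "\<dots> = (\<Prod>i\<in>{1..<Suc n}. (if odd i \<and> \<sigma> (int i) < 0 then x * z else 1) *
      (if odd i \<and> Suc i < Suc n \<and> \<sigma> (int (Suc i)) < \<sigma> (int i) then y * x ^ (2 * ((i + 1) div 2)) else 1))"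
    unfolding D N by (subst (1 2) prod.inter_filter) (simp_all only: finite_atLeastLessThan prod.distrib)
  also have "\<dots> = pair_weight (x * z) (\<lambda>i. y * x ^ (2 * Suc i)) (word_of n \<sigma>)"
    unfolding word_of_def pair_weight_eq_prod
  proof (intro prod.cong refl)
    fix i assume "i \<in> {1..<Suc n}"
    moreover have "(i + 1) div 2 = Suc ((i - 1) div 2)" if "odd i"
      using that by (auto elim: oddE)
    ultimately show "(if odd i \<and> \<sigma> (int i) < 0 then x * z else 1) *
        (if odd i \<and> Suc i < Suc n \<and> \<sigma> (int (Suc i)) < \<sigma> (int i) then y * x ^ (2 * ((i + 1) div 2)) else 1)
      = (if even (i + 1) then (if \<sigma> (int i) < 0 then x * z else 1) *
          (if Suc i < Suc n \<and> \<sigma> (int (Suc i)) < \<sigma> (int i) then y * x ^ (2 * Suc ((i - 1) div 2)) else 1) else 1)"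
      by (cases "odd i") simp_all
  qed
  finally show ?thesis .
qed

lemma even_statistics:
  fixes x y z :: "'a :: comm_ring_1"
  assumes "\<sigma> \<in> signed_perms n" "0 < n"
  shows "x ^ efmaj n \<sigma> * y ^ edes n \<sigma> * z ^ eneg n \<sigma>
    = (if hd (word_of n \<sigma>) < 0 then y else 1)
      * pair_weight (x * z) (\<lambda>i. y * x ^ (2 * Suc i)) (tl (word_of n \<sigma>))"
proof -
  define D where "D = {i \<in> {2..<Suc n}. even i \<and> Suc i < Suc n \<and> \<sigma> (int (Suc i)) < \<sigma> (int i)}"
  have D: "even_part (Des n \<sigma>) = (if \<sigma> 1 < 0 then {0} else {}) \<union> D"
  proof -
    have "i \<in> even_part (Des n \<sigma>) \<longleftrightarrow> i = 0 \<and> \<sigma> 1 < 0 \<or> i \<in> D" for i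
    proof (cases "i = 0")
      case True
      then show ?thesis
        using assms(2) signed_perm_zero [OF assms(1)] by (simp add: even_part_def Des_def D_def)
    next
      case False
      then have "even i \<longrightarrow> 2 \<le> i" by presburger
      with False show ?thesis by (auto simp: even_part_def Des_def D_def)
    qed
    then show ?thesis by auto
  qed
  have "0 \<notin> D" "finite D" by (auto simp: D_def)
  have N: "even_part (Neg n \<sigma>) = {i \<in> {2..<Suc n}. even i \<and> \<sigma> (int i) < 0}"
  proof -
    have "1 \<le> i \<longleftrightarrow> 2 \<le> i" if "even i" for i :: nat using that by presburger
    then show ?thesis
      unfolding even_part_def Neg_def by (auto simp only: mem_Collect_eq atLeastAtMost_iff atLeastLessThan_iff less_Suc_eq_le)
  qed
  have "x ^ efmaj n \<sigma> * y ^ edes n \<sigma> * z ^ eneg n \<sigma>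
      = (\<Prod>i\<in>even_part (Neg n \<sigma>). x * z) * (\<Prod>i\<in>even_part (Des n \<sigma>). y * x ^ (2 * (i div 2)))"
    by (simp add: efmaj_def emaj_def edes_def eneg_def power_add power_mult power_sum
        power_mult_distrib prod.distrib ac_simps)
  also have "(\<Prod>i\<in>even_part (Des n \<sigma>). y * x ^ (2 * (i div 2)))
      = (if \<sigma> 1 < 0 then y else 1) * (\<Prod>i\<in>D. y * x ^ (2 * (i div 2)))"
    unfolding D using \<open>0 \<notin> D\<close> \<open>finite D\<close> by simp
  also have "(\<Prod>i\<in>even_part (Neg n \<sigma>). x * z) * \<dots>
      = (if \<sigma> 1 < 0 then y else 1) * (\<Prod>i\<in>{2..<Suc n}. (if even i \<and> \<sigma> (int i) < 0 then x * z else 1) *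
      (if even i \<and> Suc i < Suc n \<and> \<sigma> (int (Suc i)) < \<sigma> (int i) then y * x ^ (2 * (i div 2)) else 1))"
    unfolding D_def N
    by (subst (1 2) prod.inter_filter) (simp_all only: finite_atLeastLessThan prod.distrib ac_simps)
  also have "(\<Prod>i\<in>{2..<Suc n}. (if even i \<and> \<sigma> (int i) < 0 then x * z else 1) *
      (if even i \<and> Suc i < Suc n \<and> \<sigma> (int (Suc i)) < \<sigma> (int i) then y * x ^ (2 * (i div 2)) else 1))
    = pair_weight (x * z) (\<lambda>i. y * x ^ (2 * Suc i)) (map (\<lambda>i. \<sigma> (int i)) [2..<Suc n])"
    unfolding pair_weight_eq_prod
  proof (intro prod.cong refl)
    fix i assume "i \<in> {2..<Suc n}"
    then have "i div 2 = Suc ((i - 2) div 2)" by auto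
    then show "(if even i \<and> \<sigma> (int i) < 0 then x * z else 1) *
        (if even i \<and> Suc i < Suc n \<and> \<sigma> (int (Suc i)) < \<sigma> (int i) then y * x ^ (2 * (i div 2)) else 1)
      = (if even (i + 2) then (if \<sigma> (int i) < 0 then x * z else 1) *
          (if Suc i < Suc n \<and> \<sigma> (int (Suc i)) < \<sigma> (int i) then y * x ^ (2 * Suc ((i - 2) div 2)) else 1) else 1)"
      by (cases "even i") simp_all
  qed
  finally have main: "x ^ efmaj n \<sigma> * y ^ edes n \<sigma> * z ^ eneg n \<sigma> = (if \<sigma> 1 < 0 then y else 1)
      * pair_weight (x * z) (\<lambda>i. y * x ^ (2 * Suc i)) (map (\<lambda>i. \<sigma> (int i)) [2..<Suc n])" .
  have "word_of n \<sigma> = \<sigma> 1 # map (\<lambda>i. \<sigma> (int i)) [2..<Suc n]"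
    using assms(2) by (simp add: word_of_def upt_conv_Cons numeral_2_eq_2 del: upt_Suc)
  then show ?thesis by (simp only: main list.sel)
qed

section \<open>The signed distributions\<close>

theorem corollary4p12:
  fixes n :: nat and x y z :: "'a :: comm_ring_1"
  assumes "n \<ge> 2"
  shows "(\<Sum>\<sigma>\<in>signed_perms n.
            (- 1) ^ (length_B n \<sigma> + neg n \<sigma>) * x ^ ofmaj n \<sigma> * y ^ odes n \<sigma> * z ^ oneg n \<sigma>)
         = of_nat (fact (n div 2)) * (1 + x * z) ^ parity_ind (n + 1) * (1 - x * z) ^ (n div 2)
           * (\<Prod>i = 1..n div 2. 1 - y * x ^ (2 * i))
       \<and> (\<Sum>\<sigma>\<in>signed_perms n.
            (- 1) ^ (length_B n \<sigma> + neg n \<sigma>) * x ^ efmaj n \<sigma> * y ^ edes n \<sigma> * z ^ eneg n \<sigma>)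
         = of_nat (parity_ind (n + 1)) * of_nat (fact (n div 2)) * (1 + y) * (1 - x * z) ^ (n div 2)
           * (\<Prod>i = 1..n div 2. 1 - y * x ^ (2 * i))"
proof -
  define A where "A = {1..int n}"
  have A: "finite A" "A \<noteq> {}" "\<forall>a\<in>A. 0 < a" "card A = n"
    using assms by (auto simp: A_def)
  have parity: "parity_ind (n + 1) = n mod 2"
    by (simp add: parity_ind_eq mod2_eq_if)
  have prod: "(\<Prod>i = 1..n div 2. 1 - y * x ^ (2 * i)) = (\<Prod>i<n div 2. 1 - y * x ^ (2 * Suc i))"
    by (simp add: prod.atLeast1_atMost_eq)
  let ?Y = "\<lambda>i. y * x ^ (2 * Suc i)"
  have "(\<Sum>\<sigma>\<in>signed_perms n.
            (- 1) ^ (length_B n \<sigma> + neg n \<sigma>) * x ^ ofmaj n \<sigma> * y ^ odes n \<sigma> * z ^ oneg n \<sigma>)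
      = (\<Sum>\<sigma>\<in>signed_perms n. abs_sign (word_of n \<sigma>) * pair_weight (x * z) ?Y (word_of n \<sigma>))"
    by (intro sum.cong refl) (simp only: mult.assoc neg_one_power_length_B odd_statistics [symmetric])
  also have "\<dots> = (\<Sum>w\<in>signed_words A. abs_sign w * pair_weight (x * z) ?Y w)"
    unfolding A_def by (rule sum.reindex_bij_betw [OF word_of_bij])
  also have "\<dots> = of_nat (fact (n div 2)) * (1 + x * z) ^ parity_ind (n + 1) * (1 - x * z) ^ (n div 2)
           * (\<Prod>i = 1..n div 2. 1 - y * x ^ (2 * i))"
    unfolding prod parity using signed_sum_pair_weight [OF A(1,3), of "x * z" ?Y] by (simp only: A(4))
  finally have odd: "(\<Sum>\<sigma>\<in>signed_perms n.
            (- 1) ^ (length_B n \<sigma> + neg n \<sigma>) * x ^ ofmaj n \<sigma> * y ^ odes n \<sigma> * z ^ oneg n \<sigma>) = \<dots>" .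
  have "(\<Sum>\<sigma>\<in>signed_perms n.
            (- 1) ^ (length_B n \<sigma> + neg n \<sigma>) * x ^ efmaj n \<sigma> * y ^ edes n \<sigma> * z ^ eneg n \<sigma>)
      = (\<Sum>\<sigma>\<in>signed_perms n. abs_sign (word_of n \<sigma>) *
          ((if hd (word_of n \<sigma>) < 0 then y else 1) * pair_weight (x * z) ?Y (tl (word_of n \<sigma>))))"
    using assms
    by (intro sum.cong refl) (simp only: mult.assoc neg_one_power_length_B even_statistics [symmetric])
  also have "\<dots> = (\<Sum>w\<in>signed_words A. abs_sign w *
          ((if hd w < 0 then y else 1) * pair_weight (x * z) ?Y (tl w)))"
    unfolding A_def by (rule sum.reindex_bij_betw [OF word_of_bij])
  also have "\<dots> = of_nat (parity_ind (n + 1)) * of_nat (fact (n div 2)) * (1 + y) * (1 - x * z) ^ (n div 2)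
           * (\<Prod>i = 1..n div 2. 1 - y * x ^ (2 * i))"
    unfolding prod parity using signed_sum_pair_weight_tl [OF A(1,2,3), of y "x * z" ?Y] by (simp only: A(4))
  finally show ?thesis using odd by blast
qed

end
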